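(* The logics ${\rm PLS}(Reg,K_1)$, ${\rm PLS}(Reg^*,K_2)$ and ${\rm PLS}(Dec,K_3)$ are sound, i.e. for $(X,K)$ any of the pairs $(Reg,K_1)$, $(Reg^*,K_2)$, $(Dec,K_3)$ and all $\Sigma\cup\{\varphi\}\subseteq Sen(L_s)$, $\Sigma\vdash_K\varphi$ implies $\Sigma\models_X\varphi$.
   Context: $L$: propositional language with atoms $p_0,p_1,\ldots$ and connectives $\neg,\wedge$ (others defined); $L_s$ adds a primitive binary connective $|$; $\sim$ is classical equivalence on $Sen(L)$, $[\alpha]=\{\beta:\beta\sim\alpha\}$. A choice function for $L$ is $f$ with $f(\alpha,\beta)=f(\{\alpha,\beta\})\in\{\alpha,\beta\}$. $Reg$: choice functions with $\alpha\sim\alpha'\Rightarrow f(\alpha,\beta)\sim f(\alpha',\beta)$. $Reg^*$: $f\in Reg$ of the form $\min_<$ for a total ordering $<$ of $Sen(L)$ (equivalently, $<$ regular: $\alpha\not\sim\beta,\alpha<\beta\Rightarrow\alpha'<\beta'$ for $\alpha'\in[\alpha],\beta'\in[\beta]$). $Dec$: $f=\min_<\in Reg^*$ with $<$ $\neg$-decreasing ($\alpha\not\sim\beta\Rightarrow(\alpha<\beta\iff\neg\beta<\neg\alpha)$). $f$ induces $\overline f:Sen(L_s)\to Sen(L)$: identity on $Sen(L)$, commuting with $\neg,\wedge$, $\overline f(\varphi|\psi)=f(\overline f(\varphi),\overline f(\psi))$; $\langle M,f\rangle\models_s\varphi$ iff $M\models\overline f(\varphi)$ for a classical truth assignment $M$;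 $\Sigma\models_X\varphi$ iff every $\langle M,f\rangle$ with $f\in X$ satisfying $\Sigma$ satisfies $\varphi$. Axiom schemes (instances over $Sen(L_s)$): PL: $\varphi\rightarrow(\psi\rightarrow\varphi)$, $(\varphi\rightarrow(\psi\rightarrow\sigma))\rightarrow((\varphi\rightarrow\psi)\rightarrow(\varphi\rightarrow\sigma))$, $(\neg\varphi\rightarrow\neg\psi)\rightarrow((\neg\varphi\rightarrow\psi)\rightarrow\varphi)$; $S_1$: $\varphi\wedge\psi\rightarrow\varphi|\psi$; $S_2$: $\varphi|\psi\rightarrow\varphi\vee\psi$; $S_3$: $\varphi|\psi\rightarrow\psi|\varphi$; $S_4$: $(\varphi|\psi)|\sigma\rightarrow\varphi|(\psi|\sigma)$; $S_5$: $\varphi\wedge\neg\psi\rightarrow(\varphi|\psi\leftrightarrow\neg\varphi|\neg\psi)$. $K_0$: axioms PL$+S_1+S_2+S_3$, rule Modus Ponens. $K_1$: same axioms as $K_0$, rules Modus Ponens and $SV$; $K_2$: $K_1$ plus $S_4$; $K_3$: $K_2$ plus $S_5$. Rule $SV$: from $\varphi\leftrightarrow\psi$ infer $\varphi|\sigma\leftrightarrow\psi|\sigma$, provided $\varphi\leftrightarrow\psi$ is provable in $K_0$. $\Sigma\vdash_K\varphi$: there is a finite sequence ending in $\varphi$ whose members are in $\Sigma$, axioms of $K$, or obtained by rules of $K$ from earlier members. *)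

theory Defs
  imports Main
begin

section \<open>Classical propositional sentences and choice functions\<close>

datatype sen = Atom nat | Neg sen | And sen sen

primrec holds :: "(nat \<Rightarrow> bool) \<Rightarrow> sen \<Rightarrow> bool" where
  "holds M (Atom n) \<longleftrightarrow> M n"
| "holds M (Neg \<alpha>) \<longleftrightarrow> \<not> holds M \<alpha>"
| "holds M (And \<alpha> \<beta>) \<longleftrightarrow> holds M \<alpha> \<and> holds M \<beta>"

definition equivalent :: "sen \<Rightarrow> sen \<Rightarrow> bool"  (infix "\<sim>" 50) where
  "\<alpha> \<sim> \<beta> \<longleftrightarrow> (\<forall>M. holds M \<alpha> \<longleftrightarrow> holds M \<beta>)"

text \<open>A choice function acts on unordered pairs, including the degenerate pairs
  \<open>{\<alpha>, \<alpha>}\<close>. Its values on all other sets of sentences are irrelevant.\<close>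

definition choice_fun :: "(sen set \<Rightarrow> sen) \<Rightarrow> bool" where
  "choice_fun f \<longleftrightarrow> (\<forall>\<alpha> \<beta>. f {\<alpha>, \<beta>} \<in> {\<alpha>, \<beta>})"

definition Reg :: "(sen set \<Rightarrow> sen) set" where
  "Reg = {f. choice_fun f \<and>
    (\<forall>\<alpha> \<alpha>' \<beta>. \<alpha> \<sim> \<alpha>' \<longrightarrow> f {\<alpha>, \<beta>} \<sim> f {\<alpha>', \<beta>})}"

definition strict_total_order :: "(sen \<Rightarrow> sen \<Rightarrow> bool) \<Rightarrow> bool" where
  "strict_total_order lt \<longleftrightarrow> irreflp lt \<and> transp lt \<and> totalp lt"

definition is_min_of :: "(sen set \<Rightarrow> sen) \<Rightarrow> (sen \<Rightarrow> sen \<Rightarrow> bool) \<Rightarrow> bool" where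
  "is_min_of f lt \<longleftrightarrow> (\<forall>\<alpha> \<beta>. f {\<alpha>, \<beta>} = (if lt \<alpha> \<beta> then \<alpha> else \<beta>))"

definition Reg_star :: "(sen set \<Rightarrow> sen) set"  ("Reg\<^sup>*") where
  "Reg\<^sup>* = {f \<in> Reg. \<exists>lt. strict_total_order lt \<and> is_min_of f lt}"

definition neg_decreasing :: "(sen \<Rightarrow> sen \<Rightarrow> bool) \<Rightarrow> bool" where
  "neg_decreasing lt \<longleftrightarrow>
    (\<forall>\<alpha> \<beta>. \<not> \<alpha> \<sim> \<beta> \<longrightarrow> (lt \<alpha> \<beta> \<longleftrightarrow> lt (Neg \<beta>) (Neg \<alpha>)))"

definition Dec :: "(sen set \<Rightarrow> sen) set" where
  "Dec = {f \<in> Reg\<^sup>*. \<exists>lt. strict_total_order lt \<and> is_min_of f lt \<and> neg_decreasing lt}"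

section \<open>Sentences with superposition and their semantics\<close>

datatype sen_s =
    SAtom nat
  | SNeg sen_s  ("\<^bold>\<not> _" [70] 70)
  | SAnd sen_s sen_s  (infixr "\<^bold>\<and>" 65)
  | SSup sen_s sen_s  (infix "\<^bold>\<bar>" 67)

abbreviation SOr :: "sen_s \<Rightarrow> sen_s \<Rightarrow> sen_s"  (infixr "\<^bold>\<or>" 64) where
  "\<phi> \<^bold>\<or> \<psi> \<equiv> \<^bold>\<not> (\<^bold>\<not> \<phi> \<^bold>\<and> \<^bold>\<not> \<psi>)"

abbreviation SImp :: "sen_s \<Rightarrow> sen_s \<Rightarrow> sen_s"  (infixr "\<^bold>\<rightarrow>" 62) where
  "\<phi> \<^bold>\<rightarrow> \<psi> \<equiv> \<^bold>\<not> (\<phi> \<^bold>\<and> \<^bold>\<not> \<psi>)"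

abbreviation SIff :: "sen_s \<Rightarrow> sen_s \<Rightarrow> sen_s"  (infix "\<^bold>\<leftrightarrow>" 61) where
  "\<phi> \<^bold>\<leftrightarrow> \<psi> \<equiv> (\<phi> \<^bold>\<rightarrow> \<psi>) \<^bold>\<and> (\<psi> \<^bold>\<rightarrow> \<phi>)"

primrec embed :: "sen \<Rightarrow> sen_s" where
  "embed (Atom n) = SAtom n"
| "embed (Neg \<alpha>) = \<^bold>\<not> embed \<alpha>"
| "embed (And \<alpha> \<beta>) = embed \<alpha> \<^bold>\<and> embed \<beta>"

primrec collapse :: "(sen set \<Rightarrow> sen) \<Rightarrow> sen_s \<Rightarrow> sen" where
  "collapse f (SAtom n) = Atom n"
| "collapse f (\<^bold>\<not> \<phi>) = Neg (collapse f \<phi>)"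
| "collapse f (\<phi> \<^bold>\<and> \<psi>) = And (collapse f \<phi>) (collapse f \<psi>)"
| "collapse f (\<phi> \<^bold>\<bar> \<psi>) = f {collapse f \<phi>, collapse f \<psi>}"

text \<open>The map induced by \<open>f\<close> is the identity on classical sentences, which are
  identified with their images under \<open>embed\<close>.\<close>

lemma collapse_embed [simp]: "collapse f (embed \<alpha>) = \<alpha>"
  by (induction \<alpha>) simp_all

definition sat_s :: "(nat \<Rightarrow> bool) \<Rightarrow> (sen set \<Rightarrow> sen) \<Rightarrow> sen_s \<Rightarrow> bool" where
  "sat_s M f \<phi> \<longleftrightarrow> holds M (collapse f \<phi>)"

definition entails :: "sen_s set \<Rightarrow> (sen set \<Rightarrow> sen) set \<Rightarrow> sen_s \<Rightarrow> bool"
    ("_ \<Turnstile>\<^bsub>_\<^esub> _" [51, 0, 51] 50) where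
  "\<Sigma> \<Turnstile>\<^bsub>X\<^esub> \<phi> \<longleftrightarrow>
    (\<forall>M. \<forall>f\<in>X. (\<forall>\<sigma>\<in>\<Sigma>. sat_s M f \<sigma>) \<longrightarrow> sat_s M f \<phi>)"

section \<open>Proof systems\<close>

text \<open>A rule instance \<open>(P, \<phi>)\<close> has premises \<open>P\<close> and conclusion \<open>\<phi>\<close>.\<close>

record calculus =
  axiom_set :: "sen_s set"
  rule_set :: "(sen_s set \<times> sen_s) set"

definition is_derivation :: "calculus \<Rightarrow> sen_s set \<Rightarrow> sen_s list \<Rightarrow> bool" where
  "is_derivation K \<Sigma> \<phi>s \<longleftrightarrow>
    (\<forall>i < length \<phi>s. \<phi>s ! i \<in> \<Sigma> \<or> \<phi>s ! i \<in> axiom_set K \<or>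
      (\<exists>P. (P, \<phi>s ! i) \<in> rule_set K \<and> P \<subseteq> set (take i \<phi>s)))"

definition derivable :: "sen_s set \<Rightarrow> calculus \<Rightarrow> sen_s \<Rightarrow> bool"
    ("_ \<turnstile>\<^bsub>_\<^esub> _" [51, 0, 51] 50) where
  "\<Sigma> \<turnstile>\<^bsub>K\<^esub> \<phi> \<longleftrightarrow> (\<exists>\<phi>s. \<phi>s \<noteq> [] \<and> last \<phi>s = \<phi> \<and> is_derivation K \<Sigma> \<phi>s)"

definition PL :: "sen_s set" where
  "PL = {\<phi> \<^bold>\<rightarrow> (\<psi> \<^bold>\<rightarrow> \<phi>) | \<phi> \<psi>. True}
    \<union> {(\<phi> \<^bold>\<rightarrow> (\<psi> \<^bold>\<rightarrow> \<sigma>)) \<^bold>\<rightarrow> ((\<phi> \<^bold>\<rightarrow> \<psi>) \<^bold>\<rightarrow> (\<phi> \<^bold>\<rightarrow> \<sigma>)) | \<phi> \<psi> \<sigma>. True}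
    \<union> {(\<^bold>\<not> \<phi> \<^bold>\<rightarrow> \<^bold>\<not> \<psi>) \<^bold>\<rightarrow> ((\<^bold>\<not> \<phi> \<^bold>\<rightarrow> \<psi>) \<^bold>\<rightarrow> \<phi>) | \<phi> \<psi>. True}"

definition S1 :: "sen_s set" where
  "S1 = {(\<phi> \<^bold>\<and> \<psi>) \<^bold>\<rightarrow> (\<phi> \<^bold>\<bar> \<psi>) | \<phi> \<psi>. True}"

definition S2 :: "sen_s set" where
  "S2 = {(\<phi> \<^bold>\<bar> \<psi>) \<^bold>\<rightarrow> (\<phi> \<^bold>\<or> \<psi>) | \<phi> \<psi>. True}"

definition S3 :: "sen_s set" where
  "S3 = {(\<phi> \<^bold>\<bar> \<psi>) \<^bold>\<rightarrow> (\<psi> \<^bold>\<bar> \<phi>) | \<phi> \<psi>. True}"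

definition S4 :: "sen_s set" where
  "S4 = {((\<phi> \<^bold>\<bar> \<psi>) \<^bold>\<bar> \<sigma>) \<^bold>\<rightarrow> (\<phi> \<^bold>\<bar> (\<psi> \<^bold>\<bar> \<sigma>)) | \<phi> \<psi> \<sigma>. True}"

definition S5 :: "sen_s set" where
  "S5 = {(\<phi> \<^bold>\<and> (\<^bold>\<not> \<psi>)) \<^bold>\<rightarrow> ((\<phi> \<^bold>\<bar> \<psi>) \<^bold>\<leftrightarrow> ((\<^bold>\<not> \<phi>) \<^bold>\<bar> (\<^bold>\<not> \<psi>))) | \<phi> \<psi>. True}"

definition modus_ponens :: "(sen_s set \<times> sen_s) set" where
  "modus_ponens = {({\<phi>, \<phi> \<^bold>\<rightarrow> \<psi>}, \<psi>) | \<phi> \<psi>. True}"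

definition K0 :: calculus where
  "K0 = \<lparr>axiom_set = PL \<union> S1 \<union> S2 \<union> S3, rule_set = modus_ponens\<rparr>"

definition SV :: "(sen_s set \<times> sen_s) set" where
  "SV = {({\<phi> \<^bold>\<leftrightarrow> \<psi>}, (\<phi> \<^bold>\<bar> \<sigma>) \<^bold>\<leftrightarrow> (\<psi> \<^bold>\<bar> \<sigma>)) | \<phi> \<psi> \<sigma>. {} \<turnstile>\<^bsub>K0\<^esub> (\<phi> \<^bold>\<leftrightarrow> \<psi>)}"

definition K1 :: calculus where
  "K1 = \<lparr>axiom_set = axiom_set K0, rule_set = modus_ponens \<union> SV\<rparr>"

definition K2 :: calculus where
  "K2 = \<lparr>axiom_set = axiom_set K1 \<union> S4, rule_set = rule_set K1\<rparr>"

definition K3 :: calculus where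
  "K3 = \<lparr>axiom_set = axiom_set K2 \<union> S5, rule_set = rule_set K2\<rparr>"

end

theory Submission
  imports Defs
begin

text \<open>Soundness is checked for one assignment \<open>M\<close> and one choice function \<open>f\<close> at a time. The rule
  \<open>SV\<close> is the only one that does not preserve truth in \<open>(M, f)\<close> merely because of the truth values
  of its premises: its side condition is provability in \<open>K0\<close>, which is sound for all choice
  functions, so the two sentences collapse under \<open>f\<close> to classically equivalent ones, and regularity
  of \<open>f\<close> applies.\<close>

text \<open>Superposition gets no clause: \<open>f\<close> chooses between sentences, so the truth
  values of the two parts do not in general settle that of the result.\<close>

lemma sat_s_simps [simp]:
  "sat_s M f (SAtom n) \<longleftrightarrow> M n"
  "sat_s M f (\<^bold>\<not> \<phi>) \<longleftrightarrow> \<not> sat_s M f \<phi>"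
  "sat_s M f (\<phi> \<^bold>\<and> \<psi>) \<longleftrightarrow> sat_s M f \<phi> \<and> sat_s M f \<psi>"
  by (simp_all add: sat_s_def)

text \<open>Serves \<open>K0\<close> as well as the systems built on it. Complete induction on
  positions is used because the premises of a rule may stand anywhere earlier in the
  derivation.\<close>

lemma derivable_sound:
  assumes "\<Sigma> \<turnstile>\<^bsub>K\<^esub> \<phi>"
    and hyps: "\<And>\<sigma>. \<sigma> \<in> \<Sigma> \<Longrightarrow> sat_s M f \<sigma>"
    and axms: "\<And>\<chi>. \<chi> \<in> axiom_set K \<Longrightarrow> sat_s M f \<chi>"
    and rules: "\<And>P \<chi>. (P, \<chi>) \<in> rule_set K \<Longrightarrow> \<forall>\<pi>\<in>P. sat_s M f \<pi> \<Longrightarrow> sat_s M f \<chi>"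
  shows "sat_s M f \<phi>"
proof -
  from assms(1) obtain \<phi>s where \<phi>s: "\<phi>s \<noteq> []" "last \<phi>s = \<phi>" and der: "is_derivation K \<Sigma> \<phi>s"
    by (auto simp: derivable_def)
  have "sat_s M f (\<phi>s ! i)" if "i < length \<phi>s" for i
    using that
  proof (induction i rule: less_induct)
    case (less i)
    have "sat_s M f \<pi>" if "\<pi> \<in> set (take i \<phi>s)" for \<pi>
      using that less by (auto simp: in_set_conv_nth)
    moreover have "\<phi>s ! i \<in> \<Sigma> \<or> \<phi>s ! i \<in> axiom_set K \<or>
        (\<exists>P. (P, \<phi>s ! i) \<in> rule_set K \<and> P \<subseteq> set (take i \<phi>s))"
      using der less.prems by (simp add: is_derivation_def)
    ultimately show ?case
      using hyps axms rules by blast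
  qed
  with \<phi>s show ?thesis
    by (metis last_conv_nth length_greater_0_conv diff_less zero_less_one)
qed

lemma sat_s_modus_ponens:
  "(P, \<chi>) \<in> modus_ponens \<Longrightarrow> \<forall>\<pi>\<in>P. sat_s M f \<pi> \<Longrightarrow> sat_s M f \<chi>"
  by (auto simp: modus_ponens_def)

lemma choice_fun_cases:
  assumes "choice_fun f"
  obtains "f {\<alpha>, \<beta>} = \<alpha>" | "f {\<alpha>, \<beta>} = \<beta>"
  using assms by (auto simp: choice_fun_def)

lemma sat_s_K0_axiom:
  assumes "choice_fun f" and "\<chi> \<in> axiom_set K0"
  shows "sat_s M f \<chi>"
proof -
  \<comment> \<open>The chosen sentence is one of the two, so it is true when both are, and if it is
    true then one of them is.\<close>
  have "sat_s M f ((\<phi> \<^bold>\<and> \<psi>) \<^bold>\<rightarrow> (\<phi> \<^bold>\<bar> \<psi>)) \<and> sat_s M f ((\<phi> \<^bold>\<bar> \<psi>) \<^bold>\<rightarrow> (\<phi> \<^bold>\<or> \<psi>))" for \<phi> \<psi>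
    using assms(1) by (rule choice_fun_cases[of f "collapse f \<phi>" "collapse f \<psi>"])
      (auto simp: sat_s_def)
  then have "sat_s M f \<chi>" if "\<chi> \<in> S1 \<union> S2"
    using that unfolding S1_def S2_def by blast
  \<comment> \<open>\<open>PL\<close> consists of tautologies, and in \<open>S3\<close> both sides
    collapse to the same sentence because \<open>f\<close> takes an unordered pair.\<close>
  moreover have "sat_s M f \<chi>" if "\<chi> \<in> PL \<union> S3"
    using that by (auto simp: PL_def S3_def sat_s_def insert_commute)
  ultimately show ?thesis
    using assms(2) by (auto simp: K0_def)
qed

lemma K0_sound:
  assumes "choice_fun f" and "{} \<turnstile>\<^bsub>K0\<^esub> \<phi>"
  shows "sat_s M f \<phi>"
  using assms(2)
proof (rule derivable_sound)
  show "sat_s M f \<chi>" if "\<chi> \<in> axiom_set K0" for \<chi>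
    using assms(1) that by (rule sat_s_K0_axiom)
  show "sat_s M f \<chi>" if "(P, \<chi>) \<in> rule_set K0" "\<forall>\<pi>\<in>P. sat_s M f \<pi>" for P \<chi>
    using that by (auto simp: K0_def intro: sat_s_modus_ponens)
qed simp

lemma sat_s_SV:
  assumes "f \<in> Reg" and "(P, \<chi>) \<in> SV"
  shows "sat_s M f \<chi>"
proof -
  from assms(2) obtain \<phi> \<psi> \<sigma> where \<chi>: "\<chi> = (\<phi> \<^bold>\<bar> \<sigma>) \<^bold>\<leftrightarrow> (\<psi> \<^bold>\<bar> \<sigma>)"
    and prov: "{} \<turnstile>\<^bsub>K0\<^esub> (\<phi> \<^bold>\<leftrightarrow> \<psi>)"
    by (auto simp: SV_def)
  have "choice_fun f"
    using assms(1) by (simp add: Reg_def)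
  \<comment> \<open>The assignment \<open>N\<close> varies while \<open>f\<close> stays fixed: truth
    at \<open>M\<close> alone would not give classical equivalence of the collapses.\<close>
  then have "sat_s N f (\<phi> \<^bold>\<leftrightarrow> \<psi>)" for N
    using prov by (rule K0_sound)
  then have "collapse f \<phi> \<sim> collapse f \<psi>"
    by (auto simp: equivalent_def sat_s_def)
  then have "f {collapse f \<phi>, collapse f \<sigma>} \<sim> f {collapse f \<psi>, collapse f \<sigma>}"
    using assms(1) by (simp add: Reg_def)
  then show ?thesis
    by (simp add: \<chi> equivalent_def sat_s_def)
qed

text \<open>Either grouping selects the least of three sentences, so the two sides of
  \<open>S4\<close> collapse to the very same sentence.\<close>

lemma sat_s_S4:
  assumes "f \<in> Reg\<^sup>*" and "\<chi> \<in> S4"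
  shows "sat_s M f \<chi>"
proof -
  from assms(1) obtain lt where ord: "strict_total_order lt" and "is_min_of f lt"
    by (auto simp: Reg_star_def)
  then have min: "f {\<alpha>, \<beta>} = (if lt \<alpha> \<beta> then \<alpha> else \<beta>)" for \<alpha> \<beta>
    by (simp add: is_min_of_def)
  have "f {f {\<alpha>, \<beta>}, \<gamma>} = f {\<alpha>, f {\<beta>, \<gamma>}}" for \<alpha> \<beta> \<gamma>
    using ord unfolding min strict_total_order_def
    by (smt (verit) irreflpD transpD totalpD)
  with assms(2) show ?thesis
    by (auto simp: S4_def sat_s_def)
qed

text \<open>Where the antecedent of \<open>S5\<close> is true, the two collapses \<alpha> and
  \<beta> differ in truth value and so are inequivalent. Negation then reverses their order:
  \<open>f\<close> picks \<alpha> from the first pair exactly when it picks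
  \<open>Neg \<beta>\<close> from the negated pair, and these are the true members of their
  pairs.\<close>

lemma sat_s_S5:
  assumes "f \<in> Dec" and "\<chi> \<in> S5"
  shows "sat_s M f \<chi>"
proof -
  from assms(1) obtain lt where ord: "strict_total_order lt" and "is_min_of f lt"
    and dec: "neg_decreasing lt"
    by (auto simp: Dec_def)
  then have min: "f {\<alpha>, \<beta>} = (if lt \<alpha> \<beta> then \<alpha> else \<beta>)" for \<alpha> \<beta>
    by (simp add: is_min_of_def)
  have "holds M (f {\<alpha>, \<beta>}) \<longleftrightarrow> holds M (f {Neg \<alpha>, Neg \<beta>})"
    if "holds M \<alpha>" "\<not> holds M \<beta>" for \<alpha> \<beta>
  proof -
    have "\<not> \<alpha> \<sim> \<beta>"
      using that by (auto simp: equivalent_def)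
    then have "lt \<alpha> \<beta> \<longleftrightarrow> lt (Neg \<beta>) (Neg \<alpha>)"
      using dec by (simp add: neg_decreasing_def)
    \<comment> \<open>Totality compares only distinct sentences; \<open>Neg \<alpha>\<close> and
      \<open>Neg \<beta>\<close> are distinct because \<open>Neg\<close> is injective and \<alpha>,
      \<beta> differ at \<open>M\<close>.\<close>
    also have "\<dots> \<longleftrightarrow> \<not> lt (Neg \<alpha>) (Neg \<beta>)"
      using ord that unfolding strict_total_order_def
      by (metis irreflpD transpD totalpD sen.inject(2))
    finally show ?thesis
      using that by (simp add: min)
  qed
  with assms(2) show ?thesis
    by (auto simp: S5_def sat_s_def)
qed

theorem theorem3p13:
  fixes X :: "(sen set \<Rightarrow> sen) set" and K :: calculus
    and \<Sigma> :: "sen_s set" and \<phi> :: sen_s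
  assumes "(X, K) \<in> {(Reg, K1), (Reg\<^sup>*, K2), (Dec, K3)}"
    and "\<Sigma> \<turnstile>\<^bsub>K\<^esub> \<phi>"
  shows "\<Sigma> \<Turnstile>\<^bsub>X\<^esub> \<phi>"
  unfolding entails_def
proof (intro allI ballI impI)
  fix M f
  assume f: "f \<in> X" and hyps: "\<forall>\<sigma>\<in>\<Sigma>. sat_s M f \<sigma>"
  have reg: "f \<in> Reg"
    using assms(1) f by (auto simp: Reg_star_def Dec_def)
  then have choice: "choice_fun f"
    by (simp add: Reg_def)
  show "sat_s M f \<phi>"
    using assms(2)
  proof (rule derivable_sound)
    show "sat_s M f \<sigma>" if "\<sigma> \<in> \<Sigma>" for \<sigma>
      using hyps that by blast
    show "sat_s M f \<chi>" if "\<chi> \<in> axiom_set K" for \<chi>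
    proof -
      \<comment> \<open>For \<open>K3\<close> the scheme \<open>S4\<close> is covered as well, since
        \<open>Dec\<close> lies inside \<open>Reg\<^sup>*\<close>.\<close>
      have "\<chi> \<in> axiom_set K0 \<or> f \<in> Reg\<^sup>* \<and> \<chi> \<in> S4 \<or> f \<in> Dec \<and> \<chi> \<in> S5"
        using assms(1) f that by (auto simp: K1_def K2_def K3_def Dec_def)
      then show ?thesis
        using sat_s_K0_axiom[OF choice] sat_s_S4 sat_s_S5 by blast
    qed
    show "sat_s M f \<chi>" if "(P, \<chi>) \<in> rule_set K" "\<forall>\<pi>\<in>P. sat_s M f \<pi>" for P \<chi>
    proof -
      have "(P, \<chi>) \<in> modus_ponens \<union> SV"
        using assms(1) that(1) by (auto simp: K1_def K2_def K3_def)
      then show ?thesis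
        using sat_s_modus_ponens sat_s_SV[OF reg] that(2) by blast
    qed
  qed
qed

end
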